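(* Let $0<\alpha_1,\alpha_2<1$, let $K_1,K_2$ be constants, let $L_x,L_y,T>0$, let $M_1,M_2,N$ be positive integers, and set $h_x=L_x/M_1$, $h_y=L_y/M_2$, $\tau=T/N$. Then the finite difference scheme (S2) described in the context is uniquely solvable: for any given data $f,\varphi$ there is exactly one grid function $\{u_{i,j}^k\mid 0\le i\le M_1,\ 0\le j\le M_2,\ 0\le k\le N\}$ satisfying it.
   Context: Grid: $\Omega=(0,L_x)\times(0,L_y)$, $x_i=ih_x$, $y_j=jh_y$, $t_k=k\tau$, $t_{k+\frac12}=(k+\tfrac12)\tau$. Operators: $\delta_x^2u_{i,j}=(u_{i+1,j}-2u_{i,j}+u_{i-1,j})/h_x^2$, $\delta_y^2u_{i,j}=(u_{i,j+1}-2u_{i,j}+u_{i,j-1})/h_y^2$; $\mathscr{L}_xu_{i,j}=\left(I+\frac{h_x^2}{12}\delta_x^2\right)u_{i,j}$ for $1\le i\le M_1-1$ and $\mathscr{L}_xu_{i,j}=u_{i,j}$ for $i=0,M_1$; $\mathscr{L}_y$ is defined analogously in the index $j$ with $h_y,\delta_y^2,M_2$. Coefficients: for $\beta\in(0,1)$, $\varpi_\ell^{(\beta)}$ are defined by $\left(\frac{3\beta+1}{2\beta}-\frac{2\beta+1}{\beta}z+\frac{\beta+1}{2\beta}z^2\right)^{\beta}=\sum_{\ell=0}^\infty\varpi_\ell^{(\beta)}z^\ell$, $|z|<1$ (branch positive at $z=0$). The scheme (S2) approximates $\partial_tu=K_1\,{}_{\mathrm{RL}}\mathrm{D}_{0,t}^{1-\alpha_1}(\partial_x^2u+\partial_y^2u)-K_2\,{}_{\mathrm{RL}}\mathrm{D}_{0,t}^{1-\alpha_2}u+f(x,y,t)$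 on $\Omega\times(0,T]$ with $u(x,y,0)=0$ and $u=\varphi$ on $\partial\Omega\times(0,T]$, and reads: for $1\le i\le M_1-1$, $1\le j\le M_2-1$, $0\le k\le N-1$, $$\mathscr{L}_x\mathscr{L}_y\frac{u_{i,j}^{k+1}-u_{i,j}^k}{\tau}=K_1\tau^{\alpha_1-1}\sum_{\ell=0}^{k}\varpi_\ell^{(1-\alpha_1)}(\mathscr{L}_y\delta_x^2+\mathscr{L}_x\delta_y^2)u_{i,j}^{k-\ell}-K_2\tau^{\alpha_2-1}\sum_{\ell=0}^{k}\varpi_\ell^{(1-\alpha_2)}\mathscr{L}_x\mathscr{L}_yu_{i,j}^{k-\ell}+\mathscr{L}_x\mathscr{L}_yf(x_i,y_j,t_{k+\frac12}),$$ with $u_{i,j}^0=0$ for all $i,j$ and $u_{i,j}^k=\varphi(x_i,y_j,t_k)$ for $(x_i,y_j)\in\partial\Omega$, $1\le k\le N$. *)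

theory Defs
  imports "HOL-Analysis.Analysis"
begin

definition wgen :: "real \<Rightarrow> complex \<Rightarrow> complex" where
  "wgen \<beta> z = of_real ((3 * \<beta> + 1) / (2 * \<beta>)) - of_real ((2 * \<beta> + 1) / \<beta>) * z
                + of_real ((\<beta> + 1) / (2 * \<beta>)) * z ^ 2"

text \<open>
  The principal power is the intended branch: it is positive at \<open>z = 0\<close>, and
  \<open>wgen \<beta> z\<close> factors as \<open>(1 - z) * (a - b * z)\<close> with \<open>0 < b < a\<close>, so for \<open>norm z < 1\<close> both
  factors lie in the right half-plane and their product avoids the branch cut.
  The lemmas \<open>varpi_ex1\<close> and \<open>varpi_sums\<close> show that the description determines the coefficients.
\<close>
definition varpi :: "real \<Rightarrow> nat \<Rightarrow> real" where
  "varpi \<beta> = (THE w. \<forall>z::complex. norm z < 1 \<longrightarrow>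
     (\<lambda>l. of_real (w l) * z ^ l) sums (wgen \<beta> z powr of_real \<beta>))"

lemma varpi_ex1:
  assumes b: "0 < \<beta>" "\<beta> < 1"
  shows "\<exists>!w::nat \<Rightarrow> real. \<forall>z::complex. norm z < 1 \<longrightarrow>
     (\<lambda>l. of_real (w l) * z ^ l) sums (wgen \<beta> z powr of_real \<beta>)"
proof (rule ex_ex1I)
  define p q where "p = (3 * \<beta> + 1) / (2 * \<beta>)" and "q = (\<beta> + 1) / (2 * \<beta>)"
  define r where "r = q / p"
  have pq: "0 < q" "q < p" "p > 0" using b by (auto simp: p_def q_def divide_strict_right_mono)
  have r: "0 < r" "r < 1" using pq by (auto simp: r_def)
  have pq2: "p + q = (2 * \<beta> + 1) / \<beta>" using b by (simp add: p_def q_def field_simps)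
  have fac: "wgen \<beta> z = (1 - z) * (1 - of_real r * z) * of_real p" for z
  proof -
    have "wgen \<beta> z = of_real p - of_real (p + q) * z + of_real q * z ^ 2"
      by (simp only: wgen_def pq2) (simp only: p_def q_def)
    also have "q = r * p" using pq by (simp add: r_def)
    finally show ?thesis by (simp add: algebra_simps power2_eq_square)
  qed
  have gb: "complex_of_real (\<beta> gchoose n) = (complex_of_real \<beta> gchoose n)" for n
    by (simp add: gbinomial_prod_rev)
  define c where "c = (\<lambda>n. (\<beta> gchoose n) * (-1) ^ n)"
  define d where "d = (\<lambda>n. (\<beta> gchoose n) * (- r) ^ n)"
  define w where "w = (\<lambda>n. p powr \<beta> * (\<Sum>i\<le>n. c i * d (n - i)))"
  have abs: "summable (\<lambda>n. norm ((complex_of_real \<beta> gchoose n) * z ^ n))" if "norm z < 1" for z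
    using that by (intro abs_summable_in_conv_radius) (auto simp: conv_radius_gchoose)
  show "\<exists>w::nat \<Rightarrow> real. \<forall>z::complex. norm z < 1 \<longrightarrow>
     (\<lambda>l. of_real (w l) * z ^ l) sums (wgen \<beta> z powr of_real \<beta>)"
  proof (intro exI allI impI)
    fix z :: complex assume z: "norm z < 1"
    have rz: "norm (of_real r * z) < 1"
    proof -
      have "r * norm z < 1 * 1" using r z by (intro mult_strict_mono) auto
      then show ?thesis using r by (simp add: norm_mult)
    qed
    have re: "Re (1 - y) > 0" if "norm y < 1" for y
      using complex_Re_le_cmod[of y] that by simp
    have nz: "1 - z \<noteq> 0" "1 - of_real r * z \<noteq> 0" using re[OF z] re[OF rz] by fastforce+
    have "\<bar>Im (Ln (1 - z))\<bar> < pi / 2" "\<bar>Im (Ln (1 - of_real r * z))\<bar> < pi / 2"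
      using Re_Ln_pos_lt[OF nz(1)] Re_Ln_pos_lt[OF nz(2)] re[OF z] re[OF rz] by auto
    then have Ln: "Ln ((1 - z) * (1 - of_real r * z)) = Ln (1 - z) + Ln (1 - of_real r * z)"
      using nz by (intro Ln_times_simple) auto
    have "Ln (of_real p * ((1 - z) * (1 - of_real r * z)))
            = of_real (ln p) + (Ln (1 - z) + Ln (1 - of_real r * z))"
      using Ln_times_of_real[OF pq(3), of "(1 - z) * (1 - of_real r * z)"] nz Ln pq(3) by (simp flip: Ln_of_real)
    then have powr: "wgen \<beta> z powr of_real \<beta>
        = of_real (p powr \<beta>) * ((1 + (- z)) powr of_real \<beta> * (1 + (- (of_real r * z))) powr of_real \<beta>)"
      using nz pq(3)
      by (simp add: fac powr_def mult.commute distrib_left exp_add exp_of_real flip: exp_of_real)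
    have s1: "(\<lambda>n. (complex_of_real \<beta> gchoose n) * (- z) ^ n) sums (1 + (- z)) powr of_real \<beta>"
      using z by (intro gen_binomial_complex) auto
    have s2: "(\<lambda>n. (complex_of_real \<beta> gchoose n) * (- (of_real r * z)) ^ n)
                sums (1 + (- (of_real r * z))) powr of_real \<beta>"
      using rz by (intro gen_binomial_complex) auto
    have "(\<lambda>n. \<Sum>i\<le>n. ((complex_of_real \<beta> gchoose i) * (- z) ^ i) *
             ((complex_of_real \<beta> gchoose (n - i)) * (- (of_real r * z)) ^ (n - i)))
          sums ((1 + (- z)) powr of_real \<beta> * (1 + (- (of_real r * z))) powr of_real \<beta>)"
      using Cauchy_product_sums[OF abs[of "- z"] abs[of "- (of_real r * z)"]] z rz
        sums_unique[OF s1] sums_unique[OF s2] by simp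
    from sums_mult[OF this, of "of_real (p powr \<beta>)"]
    show "(\<lambda>l. of_real (w l) * z ^ l) sums (wgen \<beta> z powr of_real \<beta>)"
      unfolding powr
    proof (rule sums_cong[THEN iffD1, rotated])
      fix n
      have "(complex_of_real \<beta> gchoose i) * (- z) ^ i *
             ((complex_of_real \<beta> gchoose (n - i)) * (- (of_real r * z)) ^ (n - i))
          = of_real (c i * d (n - i)) * z ^ n" if "i \<le> n" for i
      proof -
        have zn: "z ^ n = z ^ i * z ^ (n - i)" using that by (simp flip: power_add)
        have "(- z) ^ i = (-1) ^ i * z ^ i"
             "(- (of_real r * z)) ^ (n - i) = (- of_real r) ^ (n - i) * z ^ (n - i)"
          by (simp_all flip: power_mult_distrib)
        then show ?thesis
          unfolding zn by (simp add: c_def d_def gb)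
      qed
      then show "of_real (p powr \<beta>) * (\<Sum>i\<le>n. (complex_of_real \<beta> gchoose i) * (- z) ^ i *
             ((complex_of_real \<beta> gchoose (n - i)) * (- (of_real r * z)) ^ (n - i)))
          = of_real (w n) * z ^ n"
        by (simp add: w_def sum_distrib_right sum_distrib_left mult.assoc)
    qed
  qed
next
  fix v w :: "nat \<Rightarrow> real"
  assume v: "\<forall>z::complex. norm z < 1 \<longrightarrow> (\<lambda>l. of_real (v l) * z ^ l) sums (wgen \<beta> z powr of_real \<beta>)"
    and w: "\<forall>z::complex. norm z < 1 \<longrightarrow> (\<lambda>l. of_real (w l) * z ^ l) sums (wgen \<beta> z powr of_real \<beta>)"
  have s: "(\<lambda>l. complex_of_real (v l - w l) * z ^ l) sums 0" if "norm z < 1" for z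
    using sums_diff[OF v[rule_format, OF that] w[rule_format, OF that]] by (simp add: algebra_simps)
  have rad: "conv_radius (\<lambda>l. complex_of_real (v l - w l)) > 0"
    by (rule less_le_trans[OF _ conv_radius_geI[OF sums_summable[OF s[of "1/2"]]]]) auto
  have "Abs_fps (\<lambda>l. complex_of_real (v l - w l)) = 0"
  proof (rule eval_fps_eqD)
    show "eventually (\<lambda>z. eval_fps (Abs_fps (\<lambda>l. complex_of_real (v l - w l))) z = eval_fps 0 z) (nhds 0)"
    proof -
      have "eventually (\<lambda>z. z \<in> ball (0::complex) 1) (nhds 0)"
        by (rule eventually_nhds_in_open) auto
      then show ?thesis
        by (rule eventually_mono) (use sums_unique[OF s] in \<open>simp add: eval_fps_def\<close>)
    qed
  qed (use rad in \<open>auto simp: fps_conv_radius_def\<close>)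
  then have "complex_of_real (v l - w l) = 0" for l
    by (metis fps_nth_Abs_fps fps_zero_nth)
  then show "v = w" by auto
qed

lemma varpi_sums:
  assumes "0 < \<beta>" "\<beta> < 1" "norm (z::complex) < 1"
  shows "(\<lambda>l. of_real (varpi \<beta> l) * z ^ l) sums (wgen \<beta> z powr of_real \<beta>)"
  using theI'[OF varpi_ex1[OF assms(1,2)]] assms(3) unfolding varpi_def by blast

type_synonym grid = "nat \<Rightarrow> nat \<Rightarrow> real"

text \<open>
  Since \<open>i - 1\<close> truncates on natural numbers, the central differences are meaningful only for
  positive indices in the difference direction; the scheme below evaluates them only there.
\<close>
definition delta2_x :: "real \<Rightarrow> grid \<Rightarrow> grid" where
  "delta2_x hx v i j = (v (i + 1) j - 2 * v i j + v (i - 1) j) / hx ^ 2"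

definition delta2_y :: "real \<Rightarrow> grid \<Rightarrow> grid" where
  "delta2_y hy v i j = (v i (j + 1) - 2 * v i j + v i (j - 1)) / hy ^ 2"

definition comp_x :: "real \<Rightarrow> nat \<Rightarrow> grid \<Rightarrow> grid" where
  "comp_x hx M1 v i j =
     (if 1 \<le> i \<and> i \<le> M1 - 1 then v i j + hx ^ 2 / 12 * delta2_x hx v i j else v i j)"

definition comp_y :: "real \<Rightarrow> nat \<Rightarrow> grid \<Rightarrow> grid" where
  "comp_y hy M2 v i j =
     (if 1 \<le> j \<and> j \<le> M2 - 1 then v i j + hy ^ 2 / 12 * delta2_y hy v i j else v i j)"

text \<open>In a space-time grid function the time level comes first: \<open>u k i j\<close>.\<close>
definition solves_S2 ::
  "real \<Rightarrow> real \<Rightarrow> real \<Rightarrow> nat \<Rightarrow> nat \<Rightarrow> nat \<Rightarrow> real \<Rightarrow> real \<Rightarrow> real \<Rightarrow> real \<Rightarrow>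
   (real \<Rightarrow> real \<Rightarrow> real \<Rightarrow> real) \<Rightarrow> (real \<Rightarrow> real \<Rightarrow> real \<Rightarrow> real) \<Rightarrow> (nat \<Rightarrow> grid) \<Rightarrow> bool" where
  "solves_S2 Lx Ly T M1 M2 N \<alpha>1 \<alpha>2 K1 K2 f \<phi> u \<longleftrightarrow>
    (let hx = Lx / real M1; hy = Ly / real M2; \<tau> = T / real N;
         x = (\<lambda>i. real i * hx); y = (\<lambda>j. real j * hy); t = (\<lambda>k. real k * \<tau>);
         LL = (\<lambda>v. comp_x hx M1 (comp_y hy M2 v));
         A = (\<lambda>v i j. comp_y hy M2 (delta2_x hx v) i j + comp_x hx M1 (delta2_y hy v) i j)
     in
      (\<forall>k<N. \<forall>i\<in>{1..M1 - 1}. \<forall>j\<in>{1..M2 - 1}.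
         LL (\<lambda>i j. (u (k + 1) i j - u k i j) / \<tau>) i j =
           K1 * \<tau> powr (\<alpha>1 - 1) * (\<Sum>l\<le>k. varpi (1 - \<alpha>1) l * A (u (k - l)) i j)
         - K2 * \<tau> powr (\<alpha>2 - 1) * (\<Sum>l\<le>k. varpi (1 - \<alpha>2) l * LL (u (k - l)) i j)
         + LL (\<lambda>i j. f (x i) (y j) ((real k + 1 / 2) * \<tau>)) i j) \<and>
      (\<forall>i\<le>M1. \<forall>j\<le>M2. u 0 i j = 0) \<and>
      (\<forall>k\<in>{1..N}. \<forall>i\<le>M1. \<forall>j\<le>M2.
         (x i, y j) \<in> frontier ({0<..<Lx} \<times> {0<..<Ly}) \<longrightarrow> u k i j = \<phi> (x i) (y j) (t k)))"

lemma grid_frontier_iff: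
  assumes "0 < Lx" "0 < Ly" "0 < M1" "0 < M2" "i \<le> M1" "j \<le> M2"
  shows "(real i * (Lx / real M1), real j * (Ly / real M2)) \<in> frontier ({0<..<Lx} \<times> {0<..<Ly})
           \<longleftrightarrow> i = 0 \<or> i = M1 \<or> j = 0 \<or> j = M2"
proof -
  have *: "real i * (L / real M) \<in> {0..L}" "real i * (L / real M) \<in> {0<..<L} \<longleftrightarrow> i \<noteq> 0 \<and> i \<noteq> M"
    if "0 < L" "0 < M" "i \<le> M" for L :: real and i M :: nat
    using that by (auto simp: field_simps zero_less_mult_iff)
  show ?thesis
    using *[OF assms(1,3,5)] *[OF assms(2,4,6)] assms(1,2)
    by (auto simp: frontier_def closure_Times interior_Times)
qed

end

theory Submission
  imports Defs
begin

text \<open>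
  The unknown level enters the scheme only through \<open>\<L>\<^sub>x \<L>\<^sub>y u\<^sup>k\<^sup>+\<^sup>1\<close>, everything else being known
  from earlier levels; hence it suffices that \<open>\<L>\<^sub>x \<L>\<^sub>y w = r\<close> is uniquely solvable for given
  boundary values, whatever the signs of the coefficients. The operators act in different
  directions, so this reduces to two families of one-dimensional problems
  \<open>(v\<^sub>i\<^sub>-\<^sub>1 + 10 v\<^sub>i + v\<^sub>i\<^sub>+\<^sub>1) / 12 = r\<^sub>i\<close> with \<open>v\<^sub>0\<close> and \<open>v\<^sub>M\<close> prescribed. These are solved by shooting:
  \<open>v\<^sub>M\<close> is an affine function of \<open>v\<^sub>1\<close>, whose slope is nonzero because the solution of the
  homogeneous recursion starting from 0, 1 grows strictly in absolute value.
\<close>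

definition compact_stencil :: "(nat \<Rightarrow> real) \<Rightarrow> nat \<Rightarrow> real" where
  "compact_stencil v i = (v (i - 1) + 10 * v i + v (i + 1)) / 12"

text \<open>The mesh width cancels between \<open>hx ^ 2 / 12\<close> and the difference quotient,
  leaving the weights 1/12, 10/12, 1/12.\<close>

lemma comp_x_eq_stencil:
  assumes "hx \<noteq> 0" "i \<in> {1..M1 - 1}"
  shows "comp_x hx M1 v i j = compact_stencil (\<lambda>i. v i j) i"
  using assms by (simp add: comp_x_def delta2_x_def compact_stencil_def field_simps)

lemma comp_y_eq_stencil:
  assumes "hy \<noteq> 0" "j \<in> {1..M2 - 1}"
  shows "comp_y hy M2 v i j = compact_stencil (v i) j"
  using assms by (simp add: comp_y_def delta2_y_def compact_stencil_def field_simps)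

lemma comp_x_comp_y_eq_stencil:
  assumes "hx \<noteq> 0" "hy \<noteq> 0" "i \<in> {1..M1 - 1}" "j \<in> {1..M2 - 1}"
  shows "comp_x hx M1 (comp_y hy M2 v) i j = compact_stencil (\<lambda>i. compact_stencil (v i) j) i"
  using assms by (simp add: comp_x_eq_stencil comp_y_eq_stencil)

text \<open>An interior stencil reaches no index beyond \<open>M\<close>, so values off the grid
  never enter.\<close>

lemma compact_stencil_cong:
  assumes "i \<in> {1..M - 1}" "\<And>i. i \<le> M \<Longrightarrow> v i = w i"
  shows "compact_stencil v i = compact_stencil w i"
  using assms by (auto simp: compact_stencil_def)

section \<open>One-dimensional Dirichlet problems by shooting\<close>

fun shoot :: "real \<Rightarrow> real \<Rightarrow> (nat \<Rightarrow> real) \<Rightarrow> nat \<Rightarrow> real" where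
  "shoot a s r 0 = a"
| "shoot a s r (Suc 0) = s"
| "shoot a s r (Suc (Suc i)) = 12 * r (Suc i) - 10 * shoot a s r (Suc i) - shoot a s r i"

lemma compact_stencil_shoot:
  assumes "1 \<le> i"
  shows "compact_stencil (shoot a s r) i = r i"
  using assms by (cases i) (auto simp: compact_stencil_def)

lemma shoot_affine: "shoot a s r i = shoot a 0 r i + s * shoot 0 1 (\<lambda>_. 0) i"
  by (induction a s r i rule: shoot.induct) (auto simp: algebra_simps)

lemma eq_shoot:
  assumes "\<And>i. i \<in> {1..M - 1} \<Longrightarrow> compact_stencil v i = r i" "i \<le> M"
  shows "v i = shoot (v 0) (v 1) r i"
  using assms(2)
proof (induction i rule: less_induct)
  case (less i)
  show ?case
  proof (cases "i < 2")
    case True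
    then show ?thesis by (cases i) auto
  next
    case False
    then obtain m where m: "i = Suc (Suc m)" by (metis add_2_eq_Suc le_Suc_ex not_less)
    have "compact_stencil v (Suc m) = r (Suc m)" using assms(1)[of "Suc m"] less.prems m by auto
    then show ?thesis using less.IH[of m] less.IH[of "Suc m"] less.prems m
      by (simp add: compact_stencil_def)
  qed
qed

text \<open>The middle weight dominates: |v_i| < |v_{i+1}| gives |v_{i+2}| \<ge> 10 |v_{i+1}| -
  |v_i| > 9 |v_{i+1}|, and the growth starts from 0, 1.\<close>

lemma shoot_homogeneous_nonzero:
  assumes "0 < i"
  shows "shoot 0 1 (\<lambda>_. 0) i \<noteq> 0"
proof -
  have "\<bar>shoot 0 1 (\<lambda>_. 0) i\<bar> < \<bar>shoot 0 1 (\<lambda>_. 0) (Suc i)\<bar>" for i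
    by (induction i) auto
  from this[of "i - 1"] show ?thesis using assms by auto
qed

lemma stencil_dirichlet_exists:
  assumes "0 < M"
  shows "\<exists>v. v 0 = a \<and> v M = c \<and> (\<forall>i\<in>{1..M - 1}. compact_stencil v i = r i)"
proof -
  \<comment> \<open>The root of the affine equation v_M = \<open>c\<close> in the unknown second
    value.\<close>
  define s where "s = (c - shoot a 0 r M) / shoot 0 1 (\<lambda>_. 0) M"
  have "shoot a s r M = c"
    using shoot_affine[of a s r M] shoot_homogeneous_nonzero[OF assms] by (simp add: s_def)
  then show ?thesis
    by (intro exI[of _ "shoot a s r"]) (auto intro: compact_stencil_shoot)
qed

lemma stencil_dirichlet_unique:
  assumes "v 0 = w 0" "v M = w M"
    and "\<And>i. i \<in> {1..M - 1} \<Longrightarrow> compact_stencil v i = compact_stencil w i"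
    and "i \<le> M"
  shows "v i = w i"
proof (cases "M = 0")
  case True
  then show ?thesis using assms by simp
next
  case False
  define r where "r = compact_stencil w"
  have v: "v i = shoot (w 0) (v 1) r i" if "i \<le> M" for i
    using eq_shoot[of M v r i] assms(1,3) that by (simp add: r_def)
  have w: "w i = shoot (w 0) (w 1) r i" if "i \<le> M" for i
    using eq_shoot[of M w r i] that by (simp add: r_def)
  \<comment> \<open>Both sequences start at \<open>w 0\<close>, so at \<open>M\<close> they differ
    by \<open>v 1 - w 1\<close> times the nonzero slope.\<close>
  have "shoot (w 0) (v 1) r M = shoot (w 0) (w 1) r M"
    using v[of M] w[of M] assms(2) by simp
  then have "v 1 = w 1"
    using shoot_homogeneous_nonzero[of M] False
      shoot_affine[of "w 0" "v 1" r M] shoot_affine[of "w 0" "w 1" r M] by simp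
  then show ?thesis using v[OF assms(4)] w[OF assms(4)] by simp
qed

section \<open>The two-dimensional problem on one time level\<close>

text \<open>The x-problems come first, with unknown \<open>G j i\<close> standing for the y-stencil
  of \<open>w i\<close> at \<open>j\<close>. Their end values are known because \<open>w\<close> is
  prescribed along the whole edges i = 0 and i = \<open>M1\<close>. The y-problems then recover
  \<open>w\<close> from \<open>G\<close>. Extensionality turns uniqueness on the grid into equality
  of functions.\<close>

lemma grid_dirichlet_ex1:
  assumes M: "0 < M1" "0 < M2" and h: "hx \<noteq> 0" "hy \<noteq> 0"
  shows "\<exists>!w. w \<in> {..M1} \<rightarrow>\<^sub>E ({..M2} \<rightarrow>\<^sub>E (UNIV :: real set)) \<and>
    (\<forall>i\<in>{1..M1 - 1}. \<forall>j\<in>{1..M2 - 1}. comp_x hx M1 (comp_y hy M2 w) i j = r i j) \<and>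
    (\<forall>i\<le>M1. \<forall>j\<le>M2. i = 0 \<or> i = M1 \<or> j = 0 \<or> j = M2 \<longrightarrow> w i j = b i j)"
    (is "\<exists>!w. w \<in> ?X \<and> ?eq w \<and> ?bd w")
proof (rule ex_ex1I)
  have "\<forall>j. \<exists>v. v 0 = compact_stencil (b 0) j \<and> v M1 = compact_stencil (b M1) j \<and>
      (\<forall>i\<in>{1..M1 - 1}. compact_stencil v i = r i j)"
    by (intro allI stencil_dirichlet_exists M(1))
  then obtain G where G: "\<And>j. G j 0 = compact_stencil (b 0) j"
      "\<And>j. G j M1 = compact_stencil (b M1) j"
      "\<And>i j. i \<in> {1..M1 - 1} \<Longrightarrow> compact_stencil (G j) i = r i j"
    by metis
  have "\<forall>i. \<exists>v. v 0 = b i 0 \<and> v M2 = b i M2 \<and> (\<forall>j\<in>{1..M2 - 1}. compact_stencil v j = G j i)"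
    by (intro allI stencil_dirichlet_exists M(2))
  then obtain W where W: "\<And>i. W i 0 = b i 0" "\<And>i. W i M2 = b i M2"
      "\<And>i j. j \<in> {1..M2 - 1} \<Longrightarrow> compact_stencil (W i) j = G j i"
    by metis
  \<comment> \<open>Taking \<open>b\<close> itself on the edges i = 0 and i = \<open>M1\<close>
    gives the boundary values there without a proof that \<open>W\<close> agrees with
    \<open>b\<close>.\<close>
  define w where "w = (\<lambda>i\<in>{..M1}. \<lambda>j\<in>{..M2}. if i = 0 \<or> i = M1 then b i j else W i j)"
  have row: "compact_stencil (w i) j = G j i" if "i \<le> M1" "j \<in> {1..M2 - 1}" for i j
  proof -
    have "compact_stencil (w i) j = compact_stencil (if i = 0 \<or> i = M1 then b i else W i) j"
      by (rule compact_stencil_cong[OF that(2)]) (use that in \<open>simp add: w_def\<close>)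
    then show ?thesis using G W(3) that(2) by auto
  qed
  have "?eq w"
  proof (intro ballI)
    fix i j assume ij: "i \<in> {1..M1 - 1}" "j \<in> {1..M2 - 1}"
    have "compact_stencil (\<lambda>i. compact_stencil (w i) j) i = compact_stencil (G j) i"
      by (rule compact_stencil_cong[OF ij(1)]) (rule row[OF _ ij(2)])
    then show "comp_x hx M1 (comp_y hy M2 w) i j = r i j"
      using comp_x_comp_y_eq_stencil[OF h ij] G(3)[OF ij(1)] by simp
  qed
  moreover have "w \<in> ?X" by (auto simp: w_def)
  moreover have "?bd w" by (auto simp: w_def W)
  ultimately show "\<exists>w. w \<in> ?X \<and> ?eq w \<and> ?bd w" by blast
next
  fix v w assume v: "v \<in> ?X \<and> ?eq v \<and> ?bd v" and w: "w \<in> ?X \<and> ?eq w \<and> ?bd w"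
  have bd: "v i j = w i j" if "i \<le> M1" "j \<le> M2" "i = 0 \<or> i = M1 \<or> j = 0 \<or> j = M2" for i j
    using v w that by metis
  \<comment> \<open>Uniqueness in x, applied to the y-stencils of both solutions; uniqueness in y
    follows on each line of fixed i.\<close>
  have row: "compact_stencil (v i) j = compact_stencil (w i) j"
    if "i \<le> M1" and j: "j \<in> {1..M2 - 1}" for i j
  proof (rule stencil_dirichlet_unique[where M = M1 and i = i and v = "\<lambda>i. compact_stencil (v i) j"])
    show "compact_stencil (v 0) j = compact_stencil (w 0) j"
      by (rule compact_stencil_cong[OF j]) (simp add: bd)
    show "compact_stencil (v M1) j = compact_stencil (w M1) j"
      by (rule compact_stencil_cong[OF j]) (simp add: bd)
    fix i assume i: "i \<in> {1..M1 - 1}"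
    show "compact_stencil (\<lambda>i. compact_stencil (v i) j) i
        = compact_stencil (\<lambda>i. compact_stencil (w i) j) i"
      using v w i j by (simp add: comp_x_comp_y_eq_stencil[OF h i j, symmetric])
  qed (rule that)
  have "v i j = w i j" if "i \<le> M1" "j \<le> M2" for i j
    by (rule stencil_dirichlet_unique[where M = M2]) (use that bd row in auto)
  moreover have "v \<in> ?X" "w \<in> ?X" using v w by auto
  ultimately show "v = w"
    by (intro PiE_ext[of v "{..M1}" _ w] PiE_ext[of _ "{..M2}" "\<lambda>_. UNIV"]) (auto simp: PiE_mem)
qed

section \<open>Recursion over time levels with memory\<close>

text \<open>By \<open>cong\<close>, step k consults only levels up to k. Hence appending a level
  leaves the earlier steps valid, and two solutions that agree so far face the same next
  step.\<close>

lemma ex1_course_of_values: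
  fixes step :: "nat \<Rightarrow> (nat \<Rightarrow> 'a) \<Rightarrow> 'a \<Rightarrow> bool"
  assumes init: "x0 \<in> X"
    and ex1: "\<And>k u. \<exists>!w. w \<in> X \<and> step k u w"
    and cong: "\<And>k u v w. (\<And>l. l \<le> k \<Longrightarrow> u l = v l) \<Longrightarrow> step k u w \<longleftrightarrow> step k v w"
  shows "\<exists>!u. u \<in> {..N} \<rightarrow>\<^sub>E X \<and> u 0 = x0 \<and> (\<forall>k<N. step k u (u (k + 1)))"
proof (rule ex_ex1I)
  show "\<exists>u. u \<in> {..N} \<rightarrow>\<^sub>E X \<and> u 0 = x0 \<and> (\<forall>k<N. step k u (u (k + 1)))"
  proof (induction N)
    case 0
    show ?case by (intro exI[of _ "\<lambda>k\<in>{..0}. x0"]) (auto simp: init split: if_splits)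
  next
    case (Suc N)
    then obtain u where u: "u \<in> {..N} \<rightarrow>\<^sub>E X" "u 0 = x0" "\<forall>k<N. step k u (u (k + 1))" by blast
    obtain w where w: "w \<in> X" "step N u w" using ex1 by blast
    let ?u = "u(Suc N := w)"
    have "step k ?u (?u (k + 1))" if "k < Suc N" for k
    proof -
      have "step k ?u (?u (k + 1)) \<longleftrightarrow> step k u (?u (k + 1))"
        by (rule cong) (use that in auto)
      then show ?thesis using u(3) w(2) that by (cases "k = N") auto
    qed
    moreover have "?u \<in> {..Suc N} \<rightarrow>\<^sub>E X"
      using u(1) w(1) by (auto simp: PiE_iff extensional_def)
    moreover have "?u 0 = x0" using u(2) by simp
    ultimately show ?case by blast
  qed
next
  fix u v
  assume u: "u \<in> {..N} \<rightarrow>\<^sub>E X \<and> u 0 = x0 \<and> (\<forall>k<N. step k u (u (k + 1)))"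
    and v: "v \<in> {..N} \<rightarrow>\<^sub>E X \<and> v 0 = x0 \<and> (\<forall>k<N. step k v (v (k + 1)))"
  have "u k = v k" if "k \<le> N" for k
    using that
  proof (induction k rule: less_induct)
    case (less k)
    show ?case
    proof (cases k)
      case 0
      then show ?thesis using u v by simp
    next
      case (Suc m)
      \<comment> \<open>The common history makes \<open>v k\<close> a second solution of the step
        posed for \<open>u\<close>.\<close>
      have "step m u (v k) \<longleftrightarrow> step m v (v k)"
        by (rule cong) (use less Suc in auto)
      then have "step m u (u k)" "step m u (v k)" using u v Suc less.prems by auto
      moreover have "u k \<in> X" "v k \<in> X" using u v less.prems by (auto simp: PiE_iff)
      ultimately show ?thesis using ex1[of m u] by blast
    qed
  qed
  then show "u = v" using u v by (intro PiE_ext[of u "{..N}" "\<lambda>_. X" v]) auto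
qed

section \<open>Reduction of the scheme to the recursion\<close>

text \<open>Linearity of both operators; this is what isolates the unknown level.\<close>

lemma comp_x_comp_y_difference_quotient:
  "comp_x hx M1 (comp_y hy M2 (\<lambda>i j. (w i j - v i j) / \<tau>)) i j
     = (comp_x hx M1 (comp_y hy M2 w) i j - comp_x hx M1 (comp_y hy M2 v) i j) / \<tau>"
proof -
  have x: "comp_x hx M1 (\<lambda>i j. (w i j - v i j) / \<tau>)
      = (\<lambda>i j. (comp_x hx M1 w i j - comp_x hx M1 v i j) / \<tau>)" for w v
    by (intro ext) (simp add: comp_x_def delta2_x_def add_divide_distrib diff_divide_distrib algebra_simps)
  have y: "comp_y hy M2 (\<lambda>i j. (w i j - v i j) / \<tau>)
      = (\<lambda>i j. (comp_y hy M2 w i j - comp_y hy M2 v i j) / \<tau>)"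
    by (intro ext) (simp add: comp_y_def delta2_y_def add_divide_distrib diff_divide_distrib algebra_simps)
  show ?thesis by (simp add: x y)
qed

theorem theorem4p1:
  fixes \<alpha>1 \<alpha>2 K1 K2 Lx Ly T :: real and M1 M2 N :: nat
    and f \<phi> :: "real \<Rightarrow> real \<Rightarrow> real \<Rightarrow> real"
  assumes "0 < \<alpha>1" "\<alpha>1 < 1" "0 < \<alpha>2" "\<alpha>2 < 1"
    and "0 < Lx" "0 < Ly" "0 < T"
    and "0 < M1" "0 < M2" "0 < N"
  shows "\<exists>!u. u \<in> {..N} \<rightarrow>\<^sub>E ({..M1} \<rightarrow>\<^sub>E ({..M2} \<rightarrow>\<^sub>E (UNIV :: real set))) \<and>
              solves_S2 Lx Ly T M1 M2 N \<alpha>1 \<alpha>2 K1 K2 f \<phi> u"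
proof -
  define hx hy \<tau> where "hx = Lx / real M1" and "hy = Ly / real M2" and "\<tau> = T / real N"
  have pos: "hx \<noteq> 0" "hy \<noteq> 0" "\<tau> \<noteq> 0" using assms by (auto simp: hx_def hy_def \<tau>_def)
  define LL where "LL = (\<lambda>v. comp_x hx M1 (comp_y hy M2 v))"
  define A where
    "A = (\<lambda>v i j. comp_y hy M2 (delta2_x hx v) i j + comp_x hx M1 (delta2_y hy v) i j)"
  define R where "R = (\<lambda>k (u :: nat \<Rightarrow> grid) i j.
      K1 * \<tau> powr (\<alpha>1 - 1) * (\<Sum>l\<le>k. varpi (1 - \<alpha>1) l * A (u (k - l)) i j)
    - K2 * \<tau> powr (\<alpha>2 - 1) * (\<Sum>l\<le>k. varpi (1 - \<alpha>2) l * LL (u (k - l)) i j)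
    + LL (\<lambda>i j. f (real i * hx) (real j * hy) ((real k + 1 / 2) * \<tau>)) i j)"
  \<comment> \<open>The scheme multiplied by \<tau> and solved for the new level \<open>w\<close>,
    together with the boundary values at level k + 1.\<close>
  define step where "step = (\<lambda>k u w.
      (\<forall>i\<in>{1..M1 - 1}. \<forall>j\<in>{1..M2 - 1}. LL w i j = LL (u k) i j + \<tau> * R k u i j) \<and>
      (\<forall>i\<le>M1. \<forall>j\<le>M2. i = 0 \<or> i = M1 \<or> j = 0 \<or> j = M2 \<longrightarrow>
         w i j = \<phi> (real i * hx) (real j * hy) (real (k + 1) * \<tau>)))"
  let ?X = "{..M1} \<rightarrow>\<^sub>E ({..M2} \<rightarrow>\<^sub>E (UNIV :: real set))"
  let ?zero = "\<lambda>i\<in>{..M1}. \<lambda>j\<in>{..M2}. 0 :: real"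
  have quot: "LL (\<lambda>i j. (w i j - v i j) / \<tau>) i j = c \<longleftrightarrow> LL w i j = LL v i j + \<tau> * c" for w v i j c
    using pos(3) by (auto simp: LL_def comp_x_comp_y_difference_quotient field_simps)
  \<comment> \<open>The initial condition speaks of grid nodes only; membership in \<open>?X\<close>
    fixes the function elsewhere.\<close>
  have zero: "(\<forall>i\<le>M1. \<forall>j\<le>M2. w i j = 0) \<longleftrightarrow> w = ?zero" if "w \<in> ?X" for w
  proof
    assume "\<forall>i\<le>M1. \<forall>j\<le>M2. w i j = 0"
    then show "w = ?zero"
      using that by (intro PiE_ext[of w "{..M1}" _ ?zero] PiE_ext[of _ "{..M2}" "\<lambda>_. UNIV"])
        (auto simp: PiE_mem split: if_splits)
  qed simp
  \<comment> \<open>Attaches the boundary condition at level k + 1 to the step that produces this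
    level.\<close>
  have shift: "(\<forall>k\<in>{1..N}. P k) \<longleftrightarrow> (\<forall>k<N. P (k + 1))" for P
    unfolding image_Suc_lessThan[symmetric] by auto
  have bd: "(\<forall>i\<le>M1. \<forall>j\<le>M2.
        (real i * hx, real j * hy) \<in> frontier ({0<..<Lx} \<times> {0<..<Ly}) \<longrightarrow> Q i j) \<longleftrightarrow>
      (\<forall>i\<le>M1. \<forall>j\<le>M2. i = 0 \<or> i = M1 \<or> j = 0 \<or> j = M2 \<longrightarrow> Q i j)" for Q
    using grid_frontier_iff[OF assms(5,6,8,9), folded hx_def hy_def] by simp
  have "solves_S2 Lx Ly T M1 M2 N \<alpha>1 \<alpha>2 K1 K2 f \<phi> u \<longleftrightarrow>
      u 0 = ?zero \<and> (\<forall>k<N. step k u (u (k + 1)))" if "u \<in> {..N} \<rightarrow>\<^sub>E ?X" for u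
  proof -
    have u0: "u 0 \<in> ?X" using that by (rule PiE_mem) simp
    have "solves_S2 Lx Ly T M1 M2 N \<alpha>1 \<alpha>2 K1 K2 f \<phi> u \<longleftrightarrow>
      (\<forall>k<N. \<forall>i\<in>{1..M1 - 1}. \<forall>j\<in>{1..M2 - 1}.
         LL (\<lambda>i j. (u (k + 1) i j - u k i j) / \<tau>) i j = R k u i j) \<and>
      (\<forall>i\<le>M1. \<forall>j\<le>M2. u 0 i j = 0) \<and>
      (\<forall>k\<in>{1..N}. \<forall>i\<le>M1. \<forall>j\<le>M2.
         (real i * hx, real j * hy) \<in> frontier ({0<..<Lx} \<times> {0<..<Ly}) \<longrightarrow>
         u k i j = \<phi> (real i * hx) (real j * hy) (real k * \<tau>))"
      unfolding solves_S2_def Let_def hx_def hy_def \<tau>_def LL_def A_def R_def ..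
    also have "\<dots> \<longleftrightarrow> u 0 = ?zero \<and> (\<forall>k<N. step k u (u (k + 1)))"
      unfolding shift quot zero[OF u0] bd step_def by blast
    finally show ?thesis .
  qed
  moreover have "\<exists>!u. u \<in> {..N} \<rightarrow>\<^sub>E ?X \<and> u 0 = ?zero \<and> (\<forall>k<N. step k u (u (k + 1)))"
  proof (rule ex1_course_of_values)
    show "?zero \<in> ?X" by auto
    show "\<exists>!w. w \<in> ?X \<and> step k u w" for k u
      unfolding step_def LL_def by (rule grid_dirichlet_ex1[OF assms(8,9) pos(1,2)])
    show "step k u w \<longleftrightarrow> step k v w" if "\<And>l. l \<le> k \<Longrightarrow> u l = v l" for k u v w
    proof -
      \<comment> \<open>The memory sums read only levels k - l \<le> k.\<close>
      have "R k u = R k v" "u k = v k" by (simp_all add: R_def that)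
      then show ?thesis by (simp add: step_def)
    qed
  qed
  ultimately show ?thesis by (metis (no_types, lifting))
qed

end
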